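(* Let $V$ be a finite set and let $f,g:V\to\mathbb{R}$ be two real functions on $V$. Then, as maps on $\Lambda_n(V)$ for every $n\ge 0$, $$\partial^f\circ\partial^g=-\,\partial^g\circ\partial^f,\qquad d^f\circ d^g=-\,d^g\circ d^f.$$ In particular, taking $f=\chi_u$ and $g=\chi_v$ for $u,v\in V$, $$\frac{\partial}{\partial u}\circ\frac{\partial}{\partial v}=-\frac{\partial}{\partial v}\circ\frac{\partial}{\partial u},\qquad du\circ dv=-\,dv\circ du.$$
   Context: For an integer $n\ge 0$, an elementary $n$-path on $V$ is an ordered sequence $v_0v_1\ldots v_n$ of vertices of $V$ (repetitions allowed), and $\Lambda_n(V)$ is the real vector space with basis the set of all elementary $n$-paths on $V$. Convention: $\Lambda_{-1}(V)=\mathbb{R}e$ is spanned by the empty path $e$, and $\Lambda_{-2}(V)=0$. For $v,u\in V$ let $\delta(v,u)=1$ if $v=u$ and $0$ otherwise. For $v\in V$ and $0\le i\le n$ define the linear map $\frac{\partial_i}{\partial v}:\Lambda_n(V)\to\Lambda_{n-1}(V)$ by $\frac{\partial_i}{\partial v}(v_0\ldots v_n)=(-1)^i\delta(v,v_i)\,v_0\ldots\widehat{v_i}\ldots v_n$ (the hat means omission; for $n=0$, $\frac{\partial_0}{\partial v}(v_0)=\delta(v,v_0)e$). For $0\le i\le n+1$ define the linear map $d_iv:\Lambda_n(V)\to\Lambda_{n+1}(V)$ by $d_iv(v_0\ldots v_n)=(-1)^i\,v_0\ldots v_{i-1}\,v\,v_i\ldots v_n$. For $f:V\to\mathbb{R}$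 put $\partial_i^f=\sum_{v\in V}f(v)\frac{\partial_i}{\partial v}$ and $d_i^f=\sum_{v\in V}f(v)\,d_iv$. The $f$-weighted boundary operator is $\partial^f=\sum_{i=0}^n\partial_i^f:\Lambda_n(V)\to\Lambda_{n-1}(V)$ and the $f$-weighted co-boundary operator is $d^f=\sum_{i=0}^{n+1}d_i^f:\Lambda_n(V)\to\Lambda_{n+1}(V)$. For $v\in V$, $\chi_v:V\to\mathbb{R}$ is the characteristic function $\chi_v(u)=\delta(v,u)$, and $\frac{\partial}{\partial v}=\partial^{\chi_v}$, $dv=d^{\chi_v}$. *)

theory Defs
  imports "HOL-Analysis.Finite_Function_Topology"
begin

section \<open>Path spaces\<close>

text \<open>
  Elementary paths are lists. The formal real linear combinations of lists are the finitely
  supported functions \<^typ>\<open>'a list \<Rightarrow>\<^sub>0 real\<close>, whose real vector space structure comes from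
  the imported theory. The degree \<^term>\<open>n\<close> is an integer and an elementary \<open>n\<close>-path has
  \<open>n + 1\<close> vertices, so degree \<open>-1\<close> is spanned by the empty path and degree \<open>-2\<close> is the zero space.
\<close>

definition elem_paths :: "int \<Rightarrow> 'a set \<Rightarrow> 'a list set" where
  "elem_paths n V = {p. int (length p) = n + 1 \<and> set p \<subseteq> V}"

definition elem :: "'a list \<Rightarrow> ('a list \<Rightarrow>\<^sub>0 real)" where
  "elem p = Poly_Mapping.single p 1"

definition Lambda :: "int \<Rightarrow> 'a set \<Rightarrow> ('a list \<Rightarrow>\<^sub>0 real) set" (\<open>\<Lambda>\<close>) where
  "\<Lambda> n V = span (elem ` elem_paths n V)"

definition linear_ext :: "('a list \<Rightarrow> ('a list \<Rightarrow>\<^sub>0 real)) \<Rightarrow> ('a list \<Rightarrow>\<^sub>0 real) \<Rightarrow> ('a list \<Rightarrow>\<^sub>0 real)" where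
  "linear_ext b x = (\<Sum>p\<in>Poly_Mapping.keys x. Poly_Mapping.lookup x p *\<^sub>R b p)"


section \<open>Weighted boundary and co-boundary operators\<close>

definition delta :: "'a \<Rightarrow> 'a \<Rightarrow> real" where
  "delta v u = (if v = u then 1 else 0)"

definition chi :: "'a \<Rightarrow> 'a \<Rightarrow> real" where
  "chi v = (\<lambda>u. delta v u)"

text \<open>
  In the next definition \<^term>\<open>p ! i\<close> is only meaningful for \<^term>\<open>i < length p\<close>. This always
  holds when the operator is applied to an element of \<^term>\<open>\<Lambda> n V\<close> with \<open>0 \<le> i \<le> n\<close>.
\<close>

definition elem_boundary :: "nat \<Rightarrow> 'a \<Rightarrow> ('a list \<Rightarrow>\<^sub>0 real) \<Rightarrow> ('a list \<Rightarrow>\<^sub>0 real)" where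
  "elem_boundary i v =
     linear_ext (\<lambda>p. ((-1) ^ i * delta v (p ! i)) *\<^sub>R elem (take i p @ drop (Suc i) p))"

definition elem_coboundary :: "nat \<Rightarrow> 'a \<Rightarrow> ('a list \<Rightarrow>\<^sub>0 real) \<Rightarrow> ('a list \<Rightarrow>\<^sub>0 real)" where
  "elem_coboundary i v =
     linear_ext (\<lambda>p. (-1) ^ i *\<^sub>R elem (take i p @ v # drop i p))"

definition boundary_i :: "'a set \<Rightarrow> nat \<Rightarrow> ('a \<Rightarrow> real) \<Rightarrow> ('a list \<Rightarrow>\<^sub>0 real) \<Rightarrow> ('a list \<Rightarrow>\<^sub>0 real)" where
  "boundary_i V i f x = (\<Sum>v\<in>V. f v *\<^sub>R elem_boundary i v x)"

definition coboundary_i :: "'a set \<Rightarrow> nat \<Rightarrow> ('a \<Rightarrow> real) \<Rightarrow> ('a list \<Rightarrow>\<^sub>0 real) \<Rightarrow> ('a list \<Rightarrow>\<^sub>0 real)" where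
  "coboundary_i V i f x = (\<Sum>v\<in>V. f v *\<^sub>R elem_coboundary i v x)"

text \<open>
  The argument \<^term>\<open>n\<close> is the degree of the source space \<^term>\<open>\<Lambda> n V\<close>. In degree \<open>-1\<close> the
  boundary is an empty sum, that is, the zero map into \<^term>\<open>\<Lambda> (-2) V\<close>.
\<close>

definition boundary :: "'a set \<Rightarrow> int \<Rightarrow> ('a \<Rightarrow> real) \<Rightarrow> ('a list \<Rightarrow>\<^sub>0 real) \<Rightarrow> ('a list \<Rightarrow>\<^sub>0 real)" where
  "boundary V n f x = (\<Sum>i | int i \<le> n. boundary_i V i f x)"

definition coboundary :: "'a set \<Rightarrow> int \<Rightarrow> ('a \<Rightarrow> real) \<Rightarrow> ('a list \<Rightarrow>\<^sub>0 real) \<Rightarrow> ('a list \<Rightarrow>\<^sub>0 real)" where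
  "coboundary V n f x = (\<Sum>i | int i \<le> n + 1. coboundary_i V i f x)"

definition partial :: "'a set \<Rightarrow> int \<Rightarrow> 'a \<Rightarrow> ('a list \<Rightarrow>\<^sub>0 real) \<Rightarrow> ('a list \<Rightarrow>\<^sub>0 real)" where
  "partial V n v = boundary V n (chi v)"

definition differential :: "'a set \<Rightarrow> int \<Rightarrow> 'a \<Rightarrow> ('a list \<Rightarrow>\<^sub>0 real) \<Rightarrow> ('a list \<Rightarrow>\<^sub>0 real)" where
  "differential V n v = coboundary V n (chi v)"


section \<open>Basic facts\<close>

lemma lookup_scaleR_pm [simp]:
  fixes x :: "'a \<Rightarrow>\<^sub>0 real"
  shows "Poly_Mapping.lookup (c *\<^sub>R x) p = c * Poly_Mapping.lookup x p"
proof -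
  have "finite {i. c *\<^sub>R Poly_Mapping.lookup x i \<noteq> 0}"
    by (rule finite_subset[OF _ finite_lookup[of x]]) auto
  then show ?thesis
    by (simp add: scaleR_poly_mapping_def)
qed

lemma inj_elem: "inj elem"
proof (rule injI)
  fix p q :: "'a list" assume "elem p = elem q"
  then have "Poly_Mapping.keys (elem p) = Poly_Mapping.keys (elem q)" by simp
  then show "p = q" by (simp add: elem_def)
qed

lemma independent_elem: "independent (elem ` P)"
proof (unfold independent_explicit_module, clarify)
  fix t :: "('a list \<Rightarrow>\<^sub>0 real) set" and u :: "('a list \<Rightarrow>\<^sub>0 real) \<Rightarrow> real" and v
  assume t: "finite t" "t \<subseteq> elem ` P" and sum0: "(\<Sum>v\<in>t. u v *\<^sub>R v) = 0"
    and v: "v \<in> t"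
  from t v obtain p where p: "v = elem p" by blast
  have "0 = (\<Sum>w\<in>t. u w * Poly_Mapping.lookup w p)"
    using arg_cong[OF sum0, of "\<lambda>x. Poly_Mapping.lookup x p"] by (simp add: lookup_sum)
  also have "\<dots> = (\<Sum>w\<in>t. if w = elem p then u w else 0)"
  proof (rule sum.cong)
    fix w assume "w \<in> t"
    then obtain q where w: "w = elem q" using t by blast
    show "u w * Poly_Mapping.lookup w p = (if w = elem p then u w else 0)"
      using inj_elem by (auto simp: w elem_def lookup_single when_def inj_on_def)
  qed simp
  also have "\<dots> = u (elem p)" using t v p by simp
  finally show "u v = 0" using p by simp
qed

lemma linear_ext_elem [simp]: "linear_ext b (elem p) = b p"
  by (simp add: linear_ext_def elem_def)

lemma linear_ext_superset:
  assumes "finite S" "Poly_Mapping.keys x \<subseteq> S"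
  shows "linear_ext b x = (\<Sum>p\<in>S. Poly_Mapping.lookup x p *\<^sub>R b p)"
  unfolding linear_ext_def using assms
  by (intro sum.mono_neutral_left) (auto simp: in_keys_iff)

lemma linear_linear_ext: "linear (linear_ext b)"
proof (rule linearI)
  fix x y :: "'a list \<Rightarrow>\<^sub>0 real" and c :: real
  let ?S = "Poly_Mapping.keys x \<union> Poly_Mapping.keys y"
  show "linear_ext b (x + y) = linear_ext b x + linear_ext b y"
    using keys_add[of x y]
    by (simp add: linear_ext_superset[where S = ?S] lookup_add scaleR_add_left sum.distrib)
  have "Poly_Mapping.keys (c *\<^sub>R x) \<subseteq> Poly_Mapping.keys x"
    by (auto simp: in_keys_iff)
  then show "linear_ext b (c *\<^sub>R x) = c *\<^sub>R linear_ext b x"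
    by (simp add: linear_ext_superset[where S = "Poly_Mapping.keys x"] scaleR_sum_right)
qed

lemma elem_boundary_elem:
  "elem_boundary i v (elem p) = ((-1) ^ i * delta v (p ! i)) *\<^sub>R elem (take i p @ drop (Suc i) p)"
  by (simp add: elem_boundary_def)

lemma elem_coboundary_elem:
  "elem_coboundary i v (elem p) = (-1) ^ i *\<^sub>R elem (take i p @ v # drop i p)"
  by (simp add: elem_coboundary_def)

lemma linear_boundary: "linear (boundary V n f)"
  unfolding boundary_def boundary_i_def elem_boundary_def
  by (intro linear_compose_sum ballI linear_compose_scale_right linear_linear_ext)

lemma linear_coboundary: "linear (coboundary V n f)"
  unfolding coboundary_def coboundary_i_def elem_coboundary_def
  by (intro linear_compose_sum ballI linear_compose_scale_right linear_linear_ext)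

lemma elem_in_Lambda: "p \<in> elem_paths n V \<Longrightarrow> elem p \<in> \<Lambda> n V"
  unfolding Lambda_def by (simp add: span_base)

lemma linear_image_Lambda:
  assumes "linear h" "x \<in> \<Lambda> n V" "\<And>p. p \<in> elem_paths n V \<Longrightarrow> h (elem p) \<in> \<Lambda> m W"
  shows "h x \<in> \<Lambda> m W"
proof -
  have "h ` \<Lambda> n V = span (h ` elem ` elem_paths n V)"
    unfolding Lambda_def using linear_span_image[OF assms(1)] by simp
  also have "\<dots> \<subseteq> \<Lambda> m W"
    using assms(3) unfolding Lambda_def by (intro span_minimal) auto
  finally show ?thesis using assms(2) by blast
qed

lemma subspace_Lambda: "subspace (\<Lambda> n V)"
  by (simp add: Lambda_def)

lemma boundary_in_Lambda:
  assumes "x \<in> \<Lambda> n V"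
  shows "boundary V n f x \<in> \<Lambda> (n - 1) V"
proof (rule linear_image_Lambda[OF linear_boundary assms])
  fix p assume p: "p \<in> elem_paths n V"
  have "take i p @ drop (Suc i) p \<in> elem_paths (n - 1) V" if "int i \<le> n" for i
    using p that set_take_subset[of i p] set_drop_subset[of "Suc i" p]
    by (auto simp: elem_paths_def)
  then show "boundary V n f (elem p) \<in> \<Lambda> (n - 1) V"
    unfolding boundary_def boundary_i_def elem_boundary_elem
    by (intro subspace_sum subspace_Lambda subspace_scale elem_in_Lambda) auto
qed

lemma coboundary_in_Lambda:
  assumes "x \<in> \<Lambda> n V"
  shows "coboundary V n f x \<in> \<Lambda> (n + 1) V"
proof (rule linear_image_Lambda[OF linear_coboundary assms])
  fix p assume p: "p \<in> elem_paths n V"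
  have "take i p @ v # drop i p \<in> elem_paths (n + 1) V" if "int i \<le> n + 1" "v \<in> V" for i v
    using p that set_take_subset[of i p] set_drop_subset[of i p]
    by (auto simp: elem_paths_def)
  then show "coboundary V n f (elem p) \<in> \<Lambda> (n + 1) V"
    unfolding coboundary_def coboundary_i_def elem_coboundary_elem
    by (intro subspace_sum subspace_Lambda subspace_scale elem_in_Lambda) auto
qed

lemma Lambda_minus_1: "\<Lambda> (-1) V = range (\<lambda>c. c *\<^sub>R elem [])"
proof -
  have "elem_paths (-1) V = {[]}" by (auto simp: elem_paths_def)
  then show ?thesis by (simp add: Lambda_def span_singleton)
qed

lemma Lambda_minus_2: "\<Lambda> (-2) V = {0}"
  by (auto simp: Lambda_def elem_paths_def)

end

theory Submission
  imports Defs
begin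

text \<open>
  Both compositions are linear, so it suffices to compare them on an elementary path \<open>p\<close>. There
  each composition is a double sum, over two positions, of signed paths in which two vertices
  have been deleted (or inserted). Carrying out the two operations in the opposite order yields
  the same path, but the larger of the two positions is shifted by one (the simplicial identities
  \<open>del_at_del_at\<close> and \<open>ins_at_ins_at\<close>). The shift changes the sign, and the order of the two
  operations decides which weight goes with which vertex; hence the term of the
  composition for \<open>(f, g)\<close> at one pair of positions is the negative of the term of the
  composition for \<open>(g, f)\<close> at the shifted pair. The lemma \<open>sum_anti_swap\<close> carries out this
  cancellation for the double sums.
\<close>

text \<open>
  A rectangle of pairs \<open>(i, j)\<close> with \<open>i \<le> m\<close>, \<open>j < m\<close> is cut along the diagonal: the pairs with
  \<open>i \<le> j\<close> are \<open>(a, b)\<close> and those with \<open>j < i\<close> are \<open>(b + 1, a)\<close>, where \<open>a \<le> b < m\<close>.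
\<close>

lemma sum_rectangle_split:
  fixes F :: "nat \<Rightarrow> nat \<Rightarrow> 'b::ab_group_add"
  shows "(\<Sum>i<Suc m. \<Sum>j<m. F i j) = (\<Sum>b<m. \<Sum>a<Suc b. F (Suc b) a + F a b)"
proof (induction m)
  case 0
  show ?case by simp
next
  case (Suc m)
  have "(\<Sum>i<Suc (Suc m). \<Sum>j<Suc m. F i j)
      = (\<Sum>i<Suc m. \<Sum>j<m. F i j) + (\<Sum>i<Suc m. F i m) + (\<Sum>j<Suc m. F (Suc m) j)"
    by (simp add: sum.distrib algebra_simps)
  also have "\<dots> = (\<Sum>b<m. \<Sum>a<Suc b. F (Suc b) a + F a b) + (\<Sum>a<Suc m. F (Suc m) a + F a m)"
    unfolding Suc.IH by (simp only: sum.distrib add_ac)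
  also have "\<dots> = (\<Sum>b<Suc m. \<Sum>a<Suc b. F (Suc b) a + F a b)"
    by (rule sum.lessThan_Suc[symmetric])
  finally show ?case .
qed

lemma sum_anti_swap:
  fixes F G :: "nat \<Rightarrow> nat \<Rightarrow> 'b::ab_group_add"
  assumes "\<And>a b. a \<le> b \<Longrightarrow> b < m \<Longrightarrow> F (Suc b) a = - G a b"
    and "\<And>a b. a \<le> b \<Longrightarrow> b < m \<Longrightarrow> G (Suc b) a = - F a b"
  shows "(\<Sum>i<Suc m. \<Sum>j<m. F i j) = - (\<Sum>i<Suc m. \<Sum>j<m. G i j)"
  unfolding sum_rectangle_split sum_negf[symmetric]
  using assms by (intro sum.cong refl) simp


section \<open>Deleting and inserting a vertex\<close>

text \<open>The path \<open>p\<close> without its vertex at position \<open>i\<close>, counted from 0; all of \<open>p\<close> if there is no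
  such position.\<close>

definition del_at :: "nat \<Rightarrow> 'a list \<Rightarrow> 'a list" where
  "del_at i p = take i p @ drop (Suc i) p"

text \<open>The path \<open>p\<close> with \<open>v\<close> inserted so that it occupies position \<open>i\<close>, counted from 0; if \<open>p\<close> has
  fewer than \<open>i\<close> vertices, \<open>v\<close> is appended.\<close>

definition ins_at :: "nat \<Rightarrow> 'a \<Rightarrow> 'a list \<Rightarrow> 'a list" where
  "ins_at i v p = take i p @ v # drop i p"

lemma nth_del_at:
  assumes "i < length p" "j < length p - 1"
  shows "del_at i p ! j = (if j < i then p ! j else p ! Suc j)"
  using assms by (auto simp: del_at_def nth_append)

lemma length_del_at: "i < length p \<Longrightarrow> length (del_at i p) = length p - 1"
  by (auto simp: del_at_def)

lemma length_ins_at: "i \<le> length p \<Longrightarrow> length (ins_at i v p) = Suc (length p)"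
  by (auto simp: ins_at_def)

lemma nth_ins_at:
  assumes "i \<le> length p" "j \<le> length p"
  shows "ins_at i v p ! j = (if j < i then p ! j else if j = i then v else p ! (j - 1))"
  using assms by (auto simp: ins_at_def nth_append nth_Cons')

lemma del_at_in_elem_paths:
  assumes "p \<in> elem_paths n V" "i < length p"
  shows "del_at i p \<in> elem_paths (n - 1) V"
  using assms set_take_subset[of i p] set_drop_subset[of "Suc i" p]
  by (auto simp: elem_paths_def del_at_def)

lemma ins_at_in_elem_paths:
  assumes "p \<in> elem_paths n V" "i \<le> length p" "v \<in> V"
  shows "ins_at i v p \<in> elem_paths (n + 1) V"
  using assms set_take_subset[of i p] set_drop_subset[of i p]
  by (auto simp: elem_paths_def ins_at_def)

lemma del_at_del_at:
  assumes "a \<le> b" "Suc b < length p"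
  shows "del_at a (del_at (Suc b) p) = del_at b (del_at a p)"
  using assms by (intro nth_equalityI) (auto simp: length_del_at nth_del_at)

lemma ins_at_ins_at:
  assumes "a \<le> b" "b \<le> length p"
  shows "ins_at (Suc b) u (ins_at a v p) = ins_at a v (ins_at b u p)"
  using assms by (intro nth_equalityI) (auto simp: length_ins_at nth_ins_at)


section \<open>The operators on elementary paths\<close>

lemma boundary_elem:
  assumes "finite V" "p \<in> elem_paths n V"
  shows "boundary V n f (elem p) = (\<Sum>i<length p. ((-1) ^ i * f (p ! i)) *\<^sub>R elem (del_at i p))"
proof -
  have "boundary_i V i f (elem p) = ((-1) ^ i * f (p ! i)) *\<^sub>R elem (del_at i p)"
    if "i < length p" for i
  proof -
    have "p ! i \<in> V" using assms(2) that by (auto simp: elem_paths_def)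
    have "boundary_i V i f (elem p)
        = (\<Sum>v\<in>V. if v = p ! i then ((-1) ^ i * f v) *\<^sub>R elem (del_at i p) else 0)"
      unfolding boundary_i_def elem_boundary_elem
      by (intro sum.cong) (auto simp: delta_def del_at_def)
    also have "\<dots> = ((-1) ^ i * f (p ! i)) *\<^sub>R elem (del_at i p)"
      using assms(1) \<open>p ! i \<in> V\<close> by simp
    finally show ?thesis .
  qed
  moreover have "{i. int i \<le> n} = {..<length p}"
    using assms(2) by (auto simp: elem_paths_def)
  ultimately show ?thesis by (simp add: boundary_def)
qed

lemma coboundary_elem:
  assumes "p \<in> elem_paths n V"
  shows "coboundary V n f (elem p)
    = (\<Sum>i<Suc (length p). \<Sum>v\<in>V. ((-1) ^ i * f v) *\<^sub>R elem (ins_at i v p))"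
proof -
  have "{i. int i \<le> n + 1} = {..<Suc (length p)}"
    using assms by (auto simp: elem_paths_def)
  then show ?thesis
    by (simp add: coboundary_def coboundary_i_def elem_coboundary_elem ins_at_def mult.commute)
qed


section \<open>Anticommutation\<close>

lemma boundary_anticommute_elem:
  assumes V: "finite V" and p: "p \<in> elem_paths n V" and "n \<ge> 0"
  shows "boundary V (n - 1) f (boundary V n g (elem p))
    = - boundary V (n - 1) g (boundary V n f (elem p))"
proof -
  obtain m where m: "length p = Suc m"
    using p \<open>n \<ge> 0\<close> by (cases "length p") (auto simp: elem_paths_def)
  define F where "F f g i j = (((-1) ^ i * g (p ! i)) * ((-1) ^ j * f (del_at i p ! j)))
      *\<^sub>R elem (del_at j (del_at i p))" for f g :: "'a \<Rightarrow> real" and i j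
  have expand: "boundary V (n - 1) f (boundary V n g (elem p)) = (\<Sum>i<Suc m. \<Sum>j<m. F f g i j)"
    for f g
  proof -
    have "boundary V (n - 1) f (elem (del_at i p))
        = (\<Sum>j<m. ((-1) ^ j * f (del_at i p ! j)) *\<^sub>R elem (del_at j (del_at i p)))"
      if "i < Suc m" for i
      using boundary_elem[OF V del_at_in_elem_paths[OF p]] that m by (simp add: length_del_at)
    then show ?thesis
      unfolding boundary_elem[OF V p] m linear_sum[OF linear_boundary]
        linear_scale[OF linear_boundary]
      by (intro sum.cong refl) (simp add: F_def scaleR_sum_right)
  qed
  have "F f g (Suc b) a = - F g f a b" if "a \<le> b" "b < m" for f g a b
    using that m by (simp add: F_def nth_del_at del_at_del_at mult_ac)
  then show ?thesis
    unfolding expand by (intro sum_anti_swap)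
qed

lemma coboundary_anticommute_elem:
  assumes p: "p \<in> elem_paths n V"
  shows "coboundary V (n + 1) f (coboundary V n g (elem p))
    = - coboundary V (n + 1) g (coboundary V n f (elem p))"
proof -
  let ?m = "Suc (length p)"
  \<comment> \<open>Here \<open>j\<close> is the position of the first insertion and \<open>i\<close> that of the second, since the
    second one has one more position to choose from.\<close>
  define F where "F f g i j = (\<Sum>v\<in>V. \<Sum>u\<in>V. (((-1) ^ j * g v) * ((-1) ^ i * f u))
      *\<^sub>R elem (ins_at i u (ins_at j v p)))" for f g :: "'a \<Rightarrow> real" and i j
  have expand: "coboundary V (n + 1) f (coboundary V n g (elem p))
      = (\<Sum>i<Suc ?m. \<Sum>j<?m. F f g i j)" for f g
  proof -
    have step: "coboundary V (n + 1) f (elem (ins_at j v p))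
        = (\<Sum>i<Suc ?m. \<Sum>u\<in>V. ((-1) ^ i * f u) *\<^sub>R elem (ins_at i u (ins_at j v p)))"
      if "j < ?m" "v \<in> V" for j v
      using coboundary_elem[OF ins_at_in_elem_paths[OF p]] that by (simp add: length_ins_at)
    have "coboundary V (n + 1) f (coboundary V n g (elem p))
        = (\<Sum>j<?m. \<Sum>v\<in>V. \<Sum>i<Suc ?m. \<Sum>u\<in>V.
            (((-1) ^ j * g v) * ((-1) ^ i * f u)) *\<^sub>R elem (ins_at i u (ins_at j v p)))"
      unfolding coboundary_elem[OF p] linear_sum[OF linear_coboundary]
        linear_scale[OF linear_coboundary]
      by (intro sum.cong refl) (simp only: step lessThan_iff scaleR_sum_right scaleR_scaleR)
    also have "\<dots> = (\<Sum>j<?m. \<Sum>i<Suc ?m. F f g i j)"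
      unfolding F_def by (intro sum.cong refl sum.swap)
    also have "\<dots> = (\<Sum>i<Suc ?m. \<Sum>j<?m. F f g i j)"
      by (rule sum.swap)
    finally show ?thesis .
  qed
  have "F f g (Suc b) a = - F g f a b" if "a \<le> b" "b < ?m" for f g a b
  proof -
    have "F f g (Suc b) a = (\<Sum>u\<in>V. \<Sum>v\<in>V. (((-1) ^ a * g v) * ((-1) ^ Suc b * f u))
        *\<^sub>R elem (ins_at (Suc b) u (ins_at a v p)))"
      unfolding F_def by (rule sum.swap)
    also have "\<dots> = - F g f a b"
      using that by (simp add: F_def ins_at_ins_at sum_negf mult_ac)
    finally show ?thesis .
  qed
  then show ?thesis
    unfolding expand by (intro sum_anti_swap)
qed

lemma boundary_anticommute:
  assumes "finite V" "n \<ge> 0" "x \<in> \<Lambda> n V"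
  shows "boundary V (n - 1) f (boundary V n g x) = - boundary V (n - 1) g (boundary V n f x)"
proof (rule linear_eq_on_span[where f = "\<lambda>x. boundary V (n - 1) f (boundary V n g x)"])
  show "linear (\<lambda>x. boundary V (n - 1) f (boundary V n g x))"
    using linear_compose[OF linear_boundary linear_boundary] by (simp add: o_def)
  show "linear (\<lambda>x. - boundary V (n - 1) g (boundary V n f x))"
    using linear_compose[OF linear_boundary linear_boundary]
    by (intro linear_compose_neg) (simp add: o_def)
  show "x \<in> span (elem ` elem_paths n V)"
    using assms(3) by (simp add: Lambda_def)
qed (use boundary_anticommute_elem[OF assms(1) _ assms(2)] in auto)

lemma coboundary_anticommute:
  assumes "x \<in> \<Lambda> n V"
  shows "coboundary V (n + 1) f (coboundary V n g x)
    = - coboundary V (n + 1) g (coboundary V n f x)"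
proof (rule linear_eq_on_span[where f = "\<lambda>x. coboundary V (n + 1) f (coboundary V n g x)"])
  show "linear (\<lambda>x. coboundary V (n + 1) f (coboundary V n g x))"
    using linear_compose[OF linear_coboundary linear_coboundary] by (simp add: o_def)
  show "linear (\<lambda>x. - coboundary V (n + 1) g (coboundary V n f x))"
    using linear_compose[OF linear_coboundary linear_coboundary]
    by (intro linear_compose_neg) (simp add: o_def)
  show "x \<in> span (elem ` elem_paths n V)"
    using assms by (simp add: Lambda_def)
qed (use coboundary_anticommute_elem in auto)

theorem proposition2p9:
  fixes V :: "'a set" and f g :: "'a \<Rightarrow> real" and n :: int
  assumes "finite V" and "n \<ge> 0"
  shows "(\<forall>x\<in>\<Lambda> n V.
            (boundary V (n - 1) f \<circ> boundary V n g) x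
              = - (boundary V (n - 1) g \<circ> boundary V n f) x)
       \<and> (\<forall>x\<in>\<Lambda> n V.
            (coboundary V (n + 1) f \<circ> coboundary V n g) x
              = - (coboundary V (n + 1) g \<circ> coboundary V n f) x)
       \<and> (\<forall>u\<in>V. \<forall>v\<in>V. \<forall>x\<in>\<Lambda> n V.
            (partial V (n - 1) u \<circ> partial V n v) x
              = - (partial V (n - 1) v \<circ> partial V n u) x)
       \<and> (\<forall>u\<in>V. \<forall>v\<in>V. \<forall>x\<in>\<Lambda> n V.
            (differential V (n + 1) u \<circ> differential V n v) x
              = - (differential V (n + 1) v \<circ> differential V n u) x)"
  unfolding partial_def differential_def comp_apply
  using boundary_anticommute[OF assms] coboundary_anticommute by blast

end
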